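(* Let $C\in\mathbb{R}^{N\times N}$ be symmetric positive semi-definite, $G\in\mathbb{R}^{N\times N}$ positive definite (not necessarily symmetric), $\gamma>0$, and let $x(0)\in\mathbb{R}^N$ with $P_Cx(0)\ne0$. Let $B_{1,1}=V_C^\top G^{-1}CV_C$, and let $(W_m,H_m)$, $h_{m+1,m}$, $w_{m+1}$ be generated by the $C$-orthogonal Arnoldi iteration described in the context with initial vector $x(0)$, i.e. $w_1=P_Cx(0)/\|x(0)\|_C$. Let $$\epsilon_m(t)=y_m(t)-y(t),\quad y_m(t)=W_m\varphi_0\!\left(-t\,g_1(H_m)^{-1}\right)W_m^\top Cx(0),\quad y(t)=V_C\exp(-tB_{1,1}^{-1})V_C^\top x(0),$$ where $g_1(H_m)^{-1}=\gamma^{-1}(H_m^{-1}-I)$, let $r_m(t)=P_CG^{-1}C\,\frac{dy_m}{dt}(t)+y_m(t)$, and let $\beta(t)=h_{m+1,m}\gamma^{-1}e_m^\top H_m^{-1}\varphi_0(-t\,g_1(H_m)^{-1})W_m^\top Cx(0)$. Then there exist constants $K>0$, $\omega>0$, depending on $B_{1,1}^{-1}$, such that $$\|\exp(-tB_{1,1}^{-1})\|_{C_1}\le K\exp(-t\omega)\quad\text{for all }t\ge0,$$ and with such constants, for all $t\ge0$, $$\|P_C\epsilon_m(t)\|_C\le K\,t\,\varphi_1(-t\omega)\max_{0\le s\le t}\|B_{1,1}^{-1}V_C^\top r_m(s)\|_{C_1}\le K\,t\,\varphi_1(-t\omega)\,\|(I+\gamma B_{1,1}^{-1})V_C^\top 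w_{m+1}\|_{C_1}\,\sup_{\theta\in[0,1]}|\beta(t\theta)|.$$
   Context: A real square matrix $G$ is positive definite if $v^\top Gv>0$ for every nonzero real $v$. Let $n$ be the rank of $C$ and $C=V_CC_1V_C^\top$ its reduced eigenvector decomposition: $V_C\in\mathbb{R}^{N\times n}$ has orthonormal columns spanning the range of $C$, $C_1\in\mathbb{R}^{n\times n}$ is diagonal with positive entries; $P_C=V_CV_C^\top$. Norms: $\|x\|_C=\sqrt{x^*Cx}$ on $\mathbb{C}^N$; $\|x\|_{C_1}=\sqrt{x^*C_1x}$ on $\mathbb{C}^n$, and $\|T\|_{C_1}=\max_{x\ne0}\|Tx\|_{C_1}/\|x\|_{C_1}$ for $n\times n$ matrices $T$. Phi-functions: $\varphi_0(z)=e^z$, $\varphi_1(z)=(e^z-1)/z$ (with $\varphi_1(0)=1$). Put $S=P_C(C+\gamma G)^{-1}C$. The Arnoldi iteration gives a real $N\times m$ matrix $W_m=[w_1,\dots,w_m]$ with columns in the range of $C$ and $W_m^\top CW_m=I$, an upper Hessenberg $H_m\in\mathbb{R}^{m\times m}$ (invertible under these assumptions), a scalar $h_{m+1,m}$ and a vector $w_{m+1}$ in the range of $C$ such that $SW_m=W_mH_m+h_{m+1,m}w_{m+1}e_m^\top$, where $e_m$ is the $m$-th standard basis vector of $\mathbb{R}^m$. *)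

theory Defs
  imports "HOL-Analysis.Analysis"
begin

definition pos_def :: "real^'n^'n \<Rightarrow> bool" where
  "pos_def A \<longleftrightarrow> (\<forall>v. v \<noteq> 0 \<longrightarrow> v \<bullet> (A *v v) > 0)"

definition sym_pos_semidef :: "real^'n^'n \<Rightarrow> bool" where
  "sym_pos_semidef A \<longleftrightarrow> transpose A = A \<and> (\<forall>v. v \<bullet> (A *v v) \<ge> 0)"

text \<open>The index type of the columns of \<open>V\<close> plays the role of \<open>{1..n}\<close> with \<open>n = rank C\<close>.\<close>

definition reduced_eigendecomp :: "real^'N^'N \<Rightarrow> real^'n^'N \<Rightarrow> real^'n^'n \<Rightarrow> bool" where
  "reduced_eigendecomp C V D \<longleftrightarrow>
     CARD('n) = rank C \<and>
     transpose V ** V = mat 1 \<and>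
     span (columns V) = range ((*v) C) \<and>
     (\<forall>i j. i \<noteq> j \<longrightarrow> D $ i $ j = 0) \<and> (\<forall>i. D $ i $ i > 0) \<and>
     C = V ** D ** transpose V"

text \<open>The matrix function \<open>\<phi>\<^sub>0 = exp\<close>, by its power series.\<close>

definition mat_exp :: "real^'n^'n \<Rightarrow> real^'n^'n" where
  "mat_exp A = (\<Sum>k. (1 / fact k) *\<^sub>R (((**) A ^^ k) (mat 1)))"

definition phi1 :: "real \<Rightarrow> real" where
  "phi1 z = (if z = 0 then 1 else (exp z - 1) / z)"

definition cvec :: "real^'n \<Rightarrow> complex^'n" where
  "cvec v = (\<chi> i. complex_of_real (v $ i))"

abbreviation cmat :: "real^'n^'m \<Rightarrow> complex^'n^'m" where
  "cmat A \<equiv> map_matrix complex_of_real A"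

text \<open>\<open>sqrt (x\<^sup>* A x)\<close> for complex \<open>x\<close>; the quantity \<open>x\<^sup>* A x\<close> is real whenever \<open>A\<close> is symmetric.\<close>

definition wnorm :: "real^'n^'n \<Rightarrow> complex^'n \<Rightarrow> real" where
  "wnorm A x = sqrt (Re (\<Sum>i\<in>UNIV. cnj (x $ i) * (cmat A *v x) $ i))"

text \<open>For positive definite symmetric \<open>A\<close> the supremum is a maximum, by compactness of the
  unit sphere.\<close>

definition mat_wnorm :: "real^'n^'n \<Rightarrow> complex^'n^'n \<Rightarrow> real" where
  "mat_wnorm A T = (SUP x\<in>{x. x \<noteq> 0}. wnorm A (T *v x) / wnorm A x)"

definition outer :: "real^'N \<Rightarrow> real^'m \<Rightarrow> real^'m^'N" where
  "outer u v = (\<chi> i j. u $ i * v $ j)"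

text \<open>Krylov dimensions are indexed by a finite linearly ordered type, standing for
  \<open>{1..m}\<close>; \<open>Min UNIV\<close> and \<open>Max UNIV\<close> stand for \<open>1\<close> and \<open>m\<close>.\<close>

definition upper_hessenberg :: "real^'m::{finite,linorder}^'m::{finite,linorder} \<Rightarrow> bool" where
  "upper_hessenberg H \<longleftrightarrow> (\<forall>i j. (\<exists>k. j < k \<and> k < i) \<longrightarrow> H $ i $ j = 0)"

definition e_last :: "real^'m::{finite,linorder}" where
  "e_last = axis (Max UNIV) 1"

text \<open>\<open>C_arnoldi C S v W H h w\<close>: the data after the last step of the \<open>C\<close>-orthogonal Arnoldi
  iteration for \<open>S\<close> with starting vector \<open>v\<close>, where \<open>h\<close> and \<open>w\<close> are \<open>h\<^bsub>m+1,m\<^esub>\<close> and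
  \<open>w\<^bsub>m+1\<^esub>\<close>. The new vector is \<open>C\<close>-orthogonal to the previous ones unless the iteration has
  broken down (\<open>h = 0\<close>), in which case \<open>w\<close> is an arbitrary vector in the range of \<open>C\<close>.
  The normalisation of \<open>w\<close> is not needed and not imposed.\<close>

definition C_arnoldi ::
  "real^'N^'N \<Rightarrow> real^'N^'N \<Rightarrow> real^'N \<Rightarrow>
   real^'m::{finite,linorder}^'N \<Rightarrow> real^'m::{finite,linorder}^'m::{finite,linorder} \<Rightarrow> real \<Rightarrow> real^'N \<Rightarrow> bool" where
  "C_arnoldi C S v W H h w \<longleftrightarrow>
     column (Min UNIV) W = v \<and>
     (\<forall>j. column j W \<in> range ((*v) C)) \<and>
     transpose W ** C ** W = mat 1 \<and>
     upper_hessenberg H \<and>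
     w \<in> range ((*v) C) \<and>
     (h \<noteq> 0 \<longrightarrow> transpose W *v (C *v w) = 0) \<and>
     S ** W = W ** H + h *\<^sub>R outer w e_last"

lemma pos_def_invertible:
  fixes A :: "real^'n^'n"
  assumes "pos_def A"
  shows "invertible A"
proof -
  have "x = 0" if "A *v x = 0" for x
    using assms that unfolding pos_def_def by force
  then show ?thesis
    by (metis invertible_left_inverse matrix_left_invertible_ker)
qed

lemma matrix_inv_mult_vec:
  fixes A :: "real^'n^'n"
  assumes "invertible A"
  shows "A *v (matrix_inv A *v x) = x"
proof -
  have "A ** matrix_inv A = mat 1 \<and> matrix_inv A ** A = mat 1"
    using assms unfolding invertible_def matrix_inv_def by (rule someI_ex)
  then show ?thesis by (simp add: matrix_vector_mul_assoc)
qed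

lemma inner_pos_def_inv_eq_0:
  fixes A :: "real^'n^'n"
  assumes "pos_def A" "x \<bullet> (matrix_inv A *v x) = 0"
  shows "x = 0"
proof -
  define z where "z = matrix_inv A *v x"
  have x: "x = A *v z"
    using assms by (simp add: z_def matrix_inv_mult_vec pos_def_invertible)
  have "z \<bullet> (A *v z) = 0"
    using assms(2) x by (metis inner_commute z_def)
  then have "z = 0"
    using assms(1) unfolding pos_def_def by force
  then show ?thesis using x by simp
qed

text \<open>The inverses of \<open>H\<^sub>m\<close> and \<open>B\<^bsub>1,1\<^esub>\<close> are genuine ones.\<close>

lemma C_arnoldi_invertible:
  fixes C G :: "real^'N^'N" and V :: "real^'n^'N" and H :: "real^'m::{finite,linorder}^'m::{finite,linorder}"
  assumes C: "sym_pos_semidef C" and G: "pos_def G" and "\<gamma> > 0"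
    and V: "reduced_eigendecomp C V D"
    and arn: "C_arnoldi C (V ** transpose V ** matrix_inv (C + \<gamma> *\<^sub>R G) ** C) v W H h w"
  shows "invertible H"
proof -
  let ?M = "C + \<gamma> *\<^sub>R G"
  have M: "pos_def ?M"
    using C G \<open>\<gamma> > 0\<close> unfolding pos_def_def sym_pos_semidef_def
    by (simp add: matrix_vector_mult_add_rdistrib inner_add_right add_nonneg_pos
        flip: scaleR_matrix_vector_assoc)
  have CP: "C ** (V ** transpose V) = C"
  proof -
    have "C ** (V ** transpose V) = V ** D ** (transpose V ** V) ** transpose V"
      using V unfolding reduced_eigendecomp_def by (metis matrix_mul_assoc)
    then show ?thesis using V unfolding reduced_eigendecomp_def by (metis matrix_mul_rid)
  qed
  have "y = 0" if y: "H *v y = 0" for y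
  proof -
    define u where "u = W *v y"
    let ?S = "V ** transpose V ** matrix_inv ?M ** C"
    have "?S *v u = (?S ** W) *v y" by (simp add: u_def matrix_vector_mul_assoc)
    also have "\<dots> = W *v (H *v y) + h *\<^sub>R (outer w e_last *v y)"
      using arn unfolding C_arnoldi_def
      by (simp add: matrix_vector_mult_add_rdistrib matrix_vector_mul_assoc
          flip: scaleR_matrix_vector_assoc)
    also have "outer w e_last *v y = (e_last \<bullet> y) *\<^sub>R w"
      by (simp add: vec_eq_iff outer_def matrix_vector_mult_def inner_vec_def
          sum_distrib_left mult_ac)
    finally have Su: "?S *v u = (h * (e_last \<bullet> y)) *\<^sub>R w" using y by simp
    have "transpose W *v (C *v (?S *v u)) = 0"
      using arn unfolding C_arnoldi_def Su by (cases "h = 0") (simp_all add: matrix_vector_mult_scaleR)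
    moreover have "C *v (?S *v u) = C *v (matrix_inv ?M *v (C *v u))"
      by (metis CP matrix_vector_mul_assoc)
    ultimately have "y \<bullet> (transpose W *v (C *v (matrix_inv ?M *v (C *v u)))) = 0" by simp
    then have "(C *v u) \<bullet> (matrix_inv ?M *v (C *v u)) = 0"
      using C unfolding sym_pos_semidef_def u_def
      by (metis dot_lmul_matrix transpose_matrix_vector transpose_transpose)
    then have "C *v u = 0" using M inner_pos_def_inv_eq_0 by blast
    then have "(transpose W ** C ** W) *v y = 0"
      unfolding u_def by (simp flip: matrix_vector_mul_assoc)
    then show "y = 0" using arn unfolding C_arnoldi_def by simp
  qed
  then show ?thesis by (metis invertible_left_inverse matrix_left_invertible_ker)
qed

lemma B11_invertible:
  fixes C G :: "real^'N^'N" and V :: "real^'n^'N"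
  assumes G: "pos_def G" and V: "reduced_eigendecomp C V D"
  shows "invertible (transpose V ** matrix_inv G ** C ** V)"
proof -
  have CV: "C ** V = V ** D"
    using V unfolding reduced_eigendecomp_def by (metis matrix_mul_assoc matrix_mul_rid)
  have VV: "transpose V ** V = mat 1" using V unfolding reduced_eigendecomp_def by simp
  have "x = 0" if x: "(transpose V ** matrix_inv G ** C ** V) *v x = 0" for x
  proof -
    define d where "d = D *v x"
    have "transpose V *v (matrix_inv G *v (V *v d)) = 0"
      using x unfolding d_def by (metis CV matrix_mul_assoc matrix_vector_mul_assoc)
    then have "d \<bullet> (transpose V *v (matrix_inv G *v (V *v d))) = 0" by simp
    then have "(V *v d) \<bullet> (matrix_inv G *v (V *v d)) = 0"
      by (metis dot_lmul_matrix transpose_matrix_vector transpose_transpose)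
    then have "V *v d = 0" using G inner_pos_def_inv_eq_0 by blast
    then have "d = 0" by (metis VV matrix_vector_mul_assoc matrix_vector_mul_lid matrix_vector_mult_0_right)
    have "D $ i $ i * x $ i = 0" for i
    proof -
      have "0 = (\<Sum>j\<in>UNIV. D $ i $ j * x $ j)"
        using \<open>d = 0\<close> unfolding d_def by (metis (mono_tags, lifting) vec_lambda_beta zero_index matrix_vector_mult_def)
      also have "\<dots> = (\<Sum>j\<in>UNIV. if j = i then D $ i $ i * x $ i else 0)"
        using V unfolding reduced_eigendecomp_def by (intro sum.cong) auto
      finally show ?thesis by simp
    qed
    moreover have "D $ i $ i \<noteq> 0" for i
      using V unfolding reduced_eigendecomp_def by (metis less_irrefl)
    ultimately show "x = 0" by (simp add: vec_eq_iff)
  qed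
  then show ?thesis by (metis invertible_left_inverse matrix_left_invertible_ker)
qed

end

theory Submission
  imports Defs
begin

text \<open>Write \<open>M\<close> for \<open>B\<inverse>\<close>, \<open>D\<close> for the diagonal factor of \<open>C\<close>, and pass to coordinates in the range of \<open>C\<close>
  by applying \<open>V\<^sup>T\<close>. Three facts carry the argument.

  Decay. \<open>B = V\<^sup>T G\<inverse> V D\<close> is a positive definite matrix times \<open>D\<close>, so \<open>D M\<close> is positive definite
  (\<open>B11_inv_coercive\<close>). In the inner product given by \<open>D\<close> the matrix \<open>M\<close> is therefore
  coercive, and the squared \<open>D\<close>-norm of a solution of \<open>v' = -M v\<close> decreases exponentially
  (\<open>norm_flow_decay\<close>); one may even take \<open>K = 1\<close>.

  Residual. \<open>V\<^sup>T\<close> intertwines \<open>G\<inverse> C\<close> with \<open>B\<close>, and hence the shift-and-invert matrix \<open>S\<close> with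
  \<open>(I + \<gamma> M)\<inverse>\<close> (\<open>shift_invert_projected\<close>). Solving the Arnoldi relation for \<open>M\<close> shows that
  \<open>M V\<^sup>T W\<close> equals \<open>V\<^sup>T W A\<close> up to a rank-one term in the direction \<open>\<rho> = (I + \<gamma> M) V\<^sup>T w\<close>
  (\<open>arnoldi_residual\<close>). Along the Arnoldi approximation this gives \<open>M V\<^sup>T r(t) = -\<beta>(t) \<rho>\<close>, so the
  second inequality of the theorem compares two suprema of the same function.

  Error. \<open>M V\<^sup>T r\<close> is the defect of the projected approximation in the equation \<open>u' = -M u\<close>, so
  \<open>e = V\<^sup>T \<epsilon>\<close> solves \<open>e' = -M e + M V\<^sup>T r\<close>. It vanishes at \<open>0\<close> because the \<open>C\<close>-orthogonal
  projection onto the Krylov space reproduces its first basis vector (\<open>arnoldi_initial\<close>).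
  Duhamel's formula together with the decay bound gives the first inequality (\<open>duhamel_bound\<close>),
  the factor \<open>t \<phi>\<^sub>1(-t \<omega>)\<close> being the integral of \<open>exp (-s \<omega>)\<close> over \<open>[0, t]\<close>.

  All weighted norms are reduced to Euclidean ones by a factorisation \<open>D = L\<^sup>T L\<close>.\<close>

section \<open>The matrix exponential\<close>

lemma bounded_bilinear_matrix_mult:
  "bounded_bilinear ((**) :: real^'n^'m \<Rightarrow> real^'p^'n \<Rightarrow> real^'p^'m)"
  unfolding bilinear_conv_bounded_bilinear[symmetric] bilinear_def linear_iff
  by (simp add: vec_eq_iff matrix_matrix_mult_def sum.distrib algebra_simps sum_distrib_left)

lemma bounded_bilinear_matrix_vector_mult:
  "bounded_bilinear ((*v) :: real^'n^'m \<Rightarrow> real^'n \<Rightarrow> real^'m)"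
  unfolding bilinear_conv_bounded_bilinear[symmetric] bilinear_def linear_iff
  by (simp add: vec_eq_iff matrix_vector_mult_def sum.distrib algebra_simps sum_distrib_left)

interpretation mm: bounded_bilinear "(**) :: real^'n^'m \<Rightarrow> real^'p^'n \<Rightarrow> real^'p^'m"
  by (rule bounded_bilinear_matrix_mult)

interpretation mv: bounded_bilinear "(*v) :: real^'n^'m \<Rightarrow> real^'n \<Rightarrow> real^'m"
  by (rule bounded_bilinear_matrix_vector_mult)

abbreviation mpow :: "real^'n^'n \<Rightarrow> nat \<Rightarrow> real^'n^'n" where
  "mpow A k \<equiv> ((**) A ^^ k) (mat 1)"

lemma mpow_scaleR: "mpow (t *\<^sub>R A) k = t ^ k *\<^sub>R mpow A k"
  by (induction k) (simp_all add: mm.scaleR_left mm.scaleR_right)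

lemma mpow_commute: "A ** mpow A k = mpow A k ** A"
  by (induction k) (simp_all, metis matrix_mul_assoc)

lemma norm_mpow_le: "\<exists>a. \<forall>k. norm (mpow A k) \<le> norm (mat 1 :: real^'n^'n) * a ^ k"
  for A :: "real^'n^'n"
proof -
  obtain K where K: "\<And>(X::real^'n^'n) (Y::real^'n^'n). norm (X ** Y) \<le> norm X * norm Y * K" and "K \<ge> 0"
    using mm.nonneg_bounded by blast
  have "norm (mpow A k) \<le> norm (mat 1 :: real^'n^'n) * (norm A * K) ^ k" for k
  proof (induction k)
    case (Suc k)
    have "norm (mpow A (Suc k)) \<le> norm (mpow A k) * (norm A * K)"
      using K[of A "mpow A k"] by (simp add: mult_ac)
    also have "\<dots> \<le> norm (mat 1 :: real^'n^'n) * (norm A * K) ^ k * (norm A * K)"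
      using Suc \<open>K \<ge> 0\<close> by (intro mult_right_mono) auto
    finally show ?case by (simp add: mult_ac)
  qed simp
  then show ?thesis by blast
qed

lemma sums_matrixI:
  fixes F :: "nat \<Rightarrow> real^'n^'m"
  assumes "\<And>i j. (\<lambda>k. F k $ i $ j) sums (X $ i $ j)"
  shows "F sums X"
  using assms unfolding sums_def by (intro vec_tendstoI) simp

text \<open>Each entry of \<open>exp (t A)\<close> is an everywhere convergent real power series in \<open>t\<close>. So the
  matrix exponential can be differentiated entry by entry, as scalar power series are.\<close>

lemma summable_mpow_entry:
  fixes A :: "real^'n^'n"
  shows "summable (\<lambda>k. mpow A k $ i $ j / fact k * t ^ k)"
proof -
  obtain a where a: "\<And>k. norm (mpow A k) \<le> norm (mat 1 :: real^'n^'n) * a ^ k"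
    using norm_mpow_le by blast
  show ?thesis
  proof (rule summable_comparison_test')
    show "summable (\<lambda>k. norm (mat 1 :: real^'n^'n) * (inverse (fact k) * (a * \<bar>t\<bar>) ^ k))"
      by (intro summable_mult summable_exp)
    fix k :: nat assume "k \<ge> 0"
    have "\<bar>mpow A k $ i $ j\<bar> \<le> norm (mat 1 :: real^'n^'n) * a ^ k"
      using a[of k] component_le_norm_cart[of "mpow A k $ i" j] Finite_Cartesian_Product.norm_nth_le[of "mpow A k" i] by simp
    then have "\<bar>mpow A k $ i $ j\<bar> * (\<bar>t\<bar> ^ k / fact k) \<le> norm (mat 1 :: real^'n^'n) * a ^ k * (\<bar>t\<bar> ^ k / fact k)"
      by (intro mult_right_mono) auto
    then show "norm (mpow A k $ i $ j / fact k * t ^ k)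
        \<le> norm (mat 1 :: real^'n^'n) * (inverse (fact k) * (a * \<bar>t\<bar>) ^ k)"
      by (simp add: abs_mult power_abs power_mult_distrib field_simps)
  qed
qed

lemma mat_exp_scaleR_sums:
  "(\<lambda>k. (t ^ k / fact k) *\<^sub>R mpow A k) sums mat_exp (t *\<^sub>R A)"
proof -
  let ?F = "\<lambda>k. (t ^ k / fact k) *\<^sub>R mpow A k"
  have "?F sums (\<chi> i j. \<Sum>k. mpow A k $ i $ j / fact k * t ^ k)"
    by (rule sums_matrixI) (use summable_mpow_entry[of A] in \<open>simp add: sums_iff field_simps\<close>)
  then have "?F sums suminf ?F" by (simp add: sums_iff)
  then show ?thesis by (simp add: mat_exp_def mpow_scaleR)
qed

lemma mat_exp_entry:
  "mat_exp (t *\<^sub>R A) $ i $ j = (\<Sum>k. mpow A k $ i $ j / fact k * t ^ k)"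
proof -
  have "(\<lambda>k. ((t ^ k / fact k) *\<^sub>R mpow A k) $ i $ j) sums (mat_exp (t *\<^sub>R A) $ i $ j)"
    by (intro sums_vec_nth mat_exp_scaleR_sums)
  then show ?thesis by (simp add: sums_iff mult.commute)
qed

lemma mat_exp_0: "mat_exp (0 :: real^'n^'n) = mat 1"
proof -
  have "mat_exp (0 *\<^sub>R (0 :: real^'n^'n)) $ i $ j = mpow (0 :: real^'n^'n) 0 $ i $ j / fact 0" for i j
    unfolding mat_exp_entry by (rule powser_zero)
  then show ?thesis by (simp add: vec_eq_iff)
qed

lemma mat_exp_commute: "A ** mat_exp (t *\<^sub>R A) = mat_exp (t *\<^sub>R A) ** A"
proof -
  have "(\<lambda>k. (t ^ k / fact k) *\<^sub>R (A ** mpow A k)) sums (A ** mat_exp (t *\<^sub>R A))"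
    using bounded_linear.sums[OF mm.bounded_linear_right mat_exp_scaleR_sums[of t A]]
    by (simp add: mm.scaleR_right)
  moreover have "(\<lambda>k. (t ^ k / fact k) *\<^sub>R (mpow A k ** A)) sums (mat_exp (t *\<^sub>R A) ** A)"
    using bounded_linear.sums[OF mm.bounded_linear_left mat_exp_scaleR_sums[of t A]]
    by (simp add: mm.scaleR_left)
  ultimately show ?thesis by (metis (no_types, lifting) mpow_commute sums_unique2 sums_cong)
qed

lemma has_vector_derivative_cart:
  fixes f :: "real \<Rightarrow> 'a::euclidean_space ^'n"
  assumes "\<And>i. ((\<lambda>t. f t $ i) has_vector_derivative (f' $ i)) (at x within S)"
  shows "(f has_vector_derivative f') (at x within S)"
proof -
  have "((\<lambda>t. f t \<bullet> b) has_derivative (\<lambda>x. (x *\<^sub>R f') \<bullet> b)) (at x within S)" if "b \<in> Basis" for b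
  proof -
    obtain i u where b: "b = axis i u" using \<open>b \<in> Basis\<close> unfolding Basis_vec_def by blast
    show ?thesis
      using has_derivative_inner_left[OF assms[of i, unfolded has_vector_derivative_def], of u]
      by (simp add: b inner_axis)
  qed
  then show ?thesis
    unfolding has_vector_derivative_def by (subst has_derivative_componentwise_within) blast
qed


lemma mat_exp_has_vector_derivative:
  "((\<lambda>t. mat_exp (t *\<^sub>R A)) has_vector_derivative A ** mat_exp (t *\<^sub>R A)) (at t)"
proof (intro has_vector_derivative_cart)
  fix i j
  let ?c = "\<lambda>k. mpow A k $ i $ j / fact k"
  have "(\<lambda>k. ((t ^ k / fact k) *\<^sub>R (A ** mpow A k)) $ i $ j) sums ((A ** mat_exp (t *\<^sub>R A)) $ i $ j)"
    using bounded_linear.sums[OF mm.bounded_linear_right mat_exp_scaleR_sums[of t A]]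
    by (intro sums_vec_nth) (simp add: mm.scaleR_right)
  moreover have "((t ^ k / fact k) *\<^sub>R (A ** mpow A k)) $ i $ j = diffs ?c k * t ^ k" for k
    by (simp add: diffs_def del: of_nat_Suc)
  ultimately have "(\<Sum>k. diffs ?c k * t ^ k) = (A ** mat_exp (t *\<^sub>R A)) $ i $ j"
    by (simp add: sums_iff)
  then show "((\<lambda>t. mat_exp (t *\<^sub>R A) $ i $ j) has_vector_derivative
      (A ** mat_exp (t *\<^sub>R A)) $ i $ j) (at t)"
    using termdiffs_strong_converges_everywhere[of ?c t] summable_mpow_entry[of A i j]
    by (simp add: mat_exp_entry has_real_derivative_iff_has_vector_derivative)
qed

section \<open>The linear flow and its perturbation\<close>

lemma flow_has_vector_derivative:
  "((\<lambda>t. mat_exp ((- t) *\<^sub>R A) *v x) has_vector_derivative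
     - (A *v (mat_exp ((- t) *\<^sub>R A) *v x))) (at t)"
proof -
  have "((\<lambda>t. mat_exp ((- t) *\<^sub>R A)) has_vector_derivative (- 1) *\<^sub>R (A ** mat_exp ((- t) *\<^sub>R A))) (at t)"
    using vector_diff_chain_at[of uminus "-1" t "\<lambda>t. mat_exp (t *\<^sub>R A)"]
      mat_exp_has_vector_derivative[of A "- t"]
      has_vector_derivative_minus[OF has_vector_derivative_id]
    by (simp add: o_def)
  from bounded_linear.has_vector_derivative[OF mv.bounded_linear_left this, of x]
  show ?thesis by (simp add: mv.minus_left matrix_vector_mul_assoc)
qed

lemma continuous_on_flow: "continuous_on S (\<lambda>t. mat_exp ((- t) *\<^sub>R A) *v x)"
  using flow_has_vector_derivative
  by (intro continuous_at_imp_continuous_on ballI has_vector_derivative_continuous) blast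

text \<open>Along \<open>v' = -M v\<close> the squared norm of \<open>L v\<close> has derivative \<open>-2 (L v) \<bullet> (L M v)\<close>, which coercivity
  bounds by \<open>-2 \<omega>\<close> times that squared norm.\<close>

lemma norm_flow_decay:
  fixes L M :: "real^'n^'n"
  assumes coercive: "\<And>v. \<omega> * (norm (L *v v))\<^sup>2 \<le> (L *v v) \<bullet> (L *v (M *v v))" and "t \<ge> 0"
  shows "norm (L *v (mat_exp ((- t) *\<^sub>R M) *v x)) \<le> exp (- t * \<omega>) * norm (L *v x)"
proof -
  define v where "v t = mat_exp ((- t) *\<^sub>R M) *v x" for t
  \<comment> \<open>The exponential weight cancels the expected decay, so it remains to see that \<open>q\<close> is
    nonincreasing.\<close>
  define q where "q t = exp (2 * \<omega> * t) * ((L *v v t) \<bullet> (L *v v t))" for t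
  have Lv: "((\<lambda>t. L *v v t) has_vector_derivative - (L *v (M *v v t))) (at t)" for t
    using bounded_linear.has_vector_derivative[OF mv.bounded_linear_right
        flow_has_vector_derivative[of M x t], of L]
    by (simp add: v_def mv.minus_right)
  have dq: "(q has_real_derivative
      2 * exp (2 * \<omega> * t) * (\<omega> * (norm (L *v v t))\<^sup>2 - (L *v v t) \<bullet> (L *v (M *v v t)))) (at t)" for t
  proof -
    have "((\<lambda>t. (L *v v t) \<bullet> (L *v v t)) has_real_derivative
        - 2 * ((L *v v t) \<bullet> (L *v (M *v v t)))) (at t)"
      using bounded_bilinear.has_vector_derivative[OF bounded_bilinear_inner Lv Lv, of t]
      by (simp add: has_real_derivative_iff_has_vector_derivative inner_commute)
    then show ?thesis unfolding q_def
      by (auto intro!: derivative_eq_intros simp: power2_norm_eq_inner algebra_simps)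
  qed
  have "2 * exp (2 * \<omega> * t) * (\<omega> * (norm (L *v v t))\<^sup>2 - (L *v v t) \<bullet> (L *v (M *v v t))) \<le> 0" for t
    using coercive[of "v t"] by (simp add: mult_le_0_iff)
  then have "q t \<le> q 0"
    using dq by (intro DERIV_nonpos_imp_nonincreasing[OF \<open>t \<ge> 0\<close>] exI conjI)
  then have "exp (2 * \<omega> * t) * (norm (L *v v t))\<^sup>2 \<le> (norm (L *v x))\<^sup>2"
    by (simp add: q_def v_def mat_exp_0 power2_norm_eq_inner)
  moreover have "exp (2 * \<omega> * t) = (exp (t * \<omega>))\<^sup>2"
    by (simp add: mult_ac flip: exp_double)
  ultimately have "(exp (t * \<omega>) * norm (L *v v t))\<^sup>2 \<le> (norm (L *v x))\<^sup>2"
    by (simp add: power_mult_distrib)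
  then have "exp (t * \<omega>) * norm (L *v v t) \<le> norm (L *v x)"
    by (rule power2_le_imp_le) simp
  then show ?thesis by (simp add: v_def exp_minus field_simps)
qed

text \<open>The variation-of-constants formula in the form of an estimate. No integral is formed: transporting
  \<open>e s\<close> to time \<open>t\<close> along the unperturbed flow gives a path from \<open>exp (-t M) (e 0) = 0\<close> to \<open>e t\<close>
  whose velocity is the transported perturbation alone, and the mean value inequality compares it
  with a scalar path.\<close>

lemma duhamel_bound:
  fixes L M :: "real^'n^'n"
  assumes "K > 0" "\<omega> > 0" "t \<ge> 0"
    and decay: "\<And>s x. s \<ge> 0 \<Longrightarrow>
      norm (L *v (mat_exp ((- s) *\<^sub>R M) *v x)) \<le> K * exp (- s * \<omega>) * norm (L *v x)"
    and e: "\<And>s. (e has_vector_derivative - (M *v e s) + g s) (at s)"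
    and "e 0 = 0"
    and b: "\<And>s. s \<in> {0..t} \<Longrightarrow> norm (L *v g s) \<le> b"
  shows "norm (L *v e t) \<le> K * t * phi1 (- t * \<omega>) * b"
proof (cases "t = 0")
  case True
  then show ?thesis using \<open>e 0 = 0\<close> by simp
next
  case False
  then have "t > 0" using \<open>t \<ge> 0\<close> by simp
  define f where "f s = L *v (mat_exp ((s - t) *\<^sub>R M) *v e s)" for s
  \<comment> \<open>an antiderivative of the bound \<open>K * exp (- (t - s) * \<omega>) * b\<close> on the velocity of \<open>f\<close>\<close>
  define \<psi> where "\<psi> s = K * b / \<omega> * exp ((s - t) * \<omega>)" for s
  have f: "(f has_vector_derivative L *v (mat_exp ((s - t) *\<^sub>R M) *v g s)) (at s)" for s
  proof -
    have "((\<lambda>s. mat_exp ((s - t) *\<^sub>R M)) has_vector_derivative mat_exp ((s - t) *\<^sub>R M) ** M) (at s)"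
      using vector_diff_chain_at[of "\<lambda>s. s - t" 1 s "\<lambda>s. mat_exp (s *\<^sub>R M)"]
        mat_exp_has_vector_derivative[of M "s - t"]
      by (simp add: o_def mat_exp_commute has_vector_derivative_diff_const)
    from bounded_linear.has_vector_derivative[OF mv.bounded_linear_right
        mv.has_vector_derivative[OF this e], of L]
    show ?thesis unfolding f_def
      by (simp add: mv.diff_right flip: matrix_vector_mul_assoc)
  qed
  have \<psi>: "(\<psi> has_vector_derivative K * exp ((s - t) * \<omega>) * b) (at s)" for s
    unfolding \<psi>_def has_real_derivative_iff_has_vector_derivative[symmetric]
    using \<open>\<omega> > 0\<close> by (auto intro!: derivative_eq_intros)
  have "norm (f t - f 0) \<le> \<psi> t - \<psi> 0"
  proof (rule differentiable_bound_general[OF \<open>t > 0\<close> _ _ f \<psi>])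
    show "continuous_on {0..t} f"
      using f by (intro continuous_at_imp_continuous_on ballI has_vector_derivative_continuous) blast
    show "continuous_on {0..t} \<psi>"
      using \<psi> by (intro continuous_at_imp_continuous_on ballI has_vector_derivative_continuous) blast
    fix s assume s: "0 < s" "s < t"
    have "norm (L *v (mat_exp ((s - t) *\<^sub>R M) *v g s)) \<le> K * exp ((s - t) * \<omega>) * norm (L *v g s)"
      using decay[of "t - s" "g s"] s by simp
    also have "\<dots> \<le> K * exp ((s - t) * \<omega>) * b"
      using b[of s] s \<open>K > 0\<close> by (intro mult_left_mono) auto
    finally show "norm (L *v (mat_exp ((s - t) *\<^sub>R M) *v g s)) \<le> K * exp ((s - t) * \<omega>) * b" .
  qed
  moreover have "f t = L *v e t" "f 0 = 0" using \<open>e 0 = 0\<close> by (simp_all add: f_def mat_exp_0)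
  moreover have "\<psi> t - \<psi> 0 = K * t * phi1 (- t * \<omega>) * b"
    using \<open>t > 0\<close> \<open>\<omega> > 0\<close> by (simp add: \<psi>_def phi1_def field_simps)
  ultimately show ?thesis by simp
qed

lemma phi1_nonneg: "phi1 z \<ge> 0"
  by (cases "z \<ge> 0") (auto simp: phi1_def intro: divide_nonpos_nonpos)

section \<open>Weighted norms\<close>

abbreviation vec_Re :: "complex^'n \<Rightarrow> real^'n" where "vec_Re z \<equiv> (\<chi> i. Re (z $ i))"
abbreviation vec_Im :: "complex^'n \<Rightarrow> real^'n" where "vec_Im z \<equiv> (\<chi> i. Im (z $ i))"

lemma vec_Re_cmat_mult: "vec_Re (cmat A *v z) = A *v vec_Re z"
  and vec_Im_cmat_mult: "vec_Im (cmat A *v z) = A *v vec_Im z"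
  by (simp_all add: vec_eq_iff matrix_vector_mult_def map_matrix_def)

text \<open>The mixed real-imaginary terms of \<open>z\<^sup>* L\<^sup>T L z\<close> are purely imaginary, which reduces the complex
  norm to two real ones.\<close>

lemma wnorm_gram:
  fixes L :: "real^'n^'m"
  shows "wnorm (transpose L ** L) z = sqrt ((norm (L *v vec_Re z))\<^sup>2 + (norm (L *v vec_Im z))\<^sup>2)"
proof -
  let ?A = "transpose L ** L"
  have q: "x \<bullet> (?A *v x) = (norm (L *v x))\<^sup>2" for x
    by (simp add: power2_norm_eq_inner flip: matrix_vector_mul_assoc)
       (metis dot_lmul_matrix inner_commute)
  have "Re (\<Sum>i\<in>UNIV. cnj (z $ i) * (cmat ?A *v z) $ i)
      = (\<Sum>i\<in>UNIV. vec_Re z $ i * vec_Re (cmat ?A *v z) $ i + vec_Im z $ i * vec_Im (cmat ?A *v z) $ i)"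
    by simp
  also have "\<dots> = vec_Re z \<bullet> (?A *v vec_Re z) + vec_Im z \<bullet> (?A *v vec_Im z)"
    unfolding vec_Re_cmat_mult vec_Im_cmat_mult by (simp add: sum.distrib inner_vec_def)
  finally show ?thesis by (simp add: wnorm_def q)
qed

lemma wnorm_gram_cvec: "wnorm (transpose L ** L) (cvec x) = norm (L *v x)"
proof -
  have "vec_Re (cvec x) = x" "vec_Im (cvec x) = 0" by (simp_all add: cvec_def vec_eq_iff)
  then show ?thesis by (simp add: wnorm_gram)
qed

lemma wnorm_gram_cmat_le:
  fixes L T :: "real^'n^'n"
  assumes "\<And>x. norm (L *v (T *v x)) \<le> k * norm (L *v x)" and "k \<ge> 0"
  shows "wnorm (transpose L ** L) (cmat T *v z) \<le> k * wnorm (transpose L ** L) z"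
proof -
  have "(norm (L *v (T *v x)))\<^sup>2 \<le> k\<^sup>2 * (norm (L *v x))\<^sup>2" for x
    using power_mono[OF assms(1)[of x] norm_ge_zero, of 2] by (simp add: power_mult_distrib)
  from add_mono[OF this[of "vec_Re z"] this[of "vec_Im z"]]
  have "(norm (L *v (T *v vec_Re z)))\<^sup>2 + (norm (L *v (T *v vec_Im z)))\<^sup>2
      \<le> k\<^sup>2 * ((norm (L *v vec_Re z))\<^sup>2 + (norm (L *v vec_Im z))\<^sup>2)"
    by (simp add: algebra_simps)
  from real_sqrt_le_mono[OF this] show ?thesis
    using \<open>k \<ge> 0\<close> by (simp add: wnorm_gram vec_Re_cmat_mult vec_Im_cmat_mult real_sqrt_mult)
qed

lemma wnorm_gram_pos:
  fixes L :: "real^'n^'n"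
  assumes "inj ((*v) L)" and "z \<noteq> 0"
  shows "wnorm (transpose L ** L) z > 0"
proof -
  have "vec_Re z \<noteq> 0 \<or> vec_Im z \<noteq> 0" using \<open>z \<noteq> 0\<close> by (auto simp: vec_eq_iff complex_eq_iff)
  then have "L *v vec_Re z \<noteq> 0 \<or> L *v vec_Im z \<noteq> 0"
    using injD[OF assms(1), of _ 0] by auto
  then show ?thesis by (auto simp: wnorm_gram intro: add_pos_nonneg add_nonneg_pos)
qed

lemma mat_wnorm_gram_le:
  fixes L T :: "real^'n^'n"
  assumes "\<And>x. norm (L *v (T *v x)) \<le> k * norm (L *v x)" and "k \<ge> 0"
    and inj: "inj ((*v) L)"
  shows "mat_wnorm (transpose L ** L) (cmat T) \<le> k"
  unfolding mat_wnorm_def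
proof (rule cSUP_least)
  have "(1 :: complex^'n) \<noteq> 0" by simp
  then show "{x :: complex^'n. x \<noteq> 0} \<noteq> {}" by blast
qed (use wnorm_gram_cmat_le[OF assms(1,2)] wnorm_gram_pos[OF inj] in \<open>auto simp: divide_le_eq\<close>)

text \<open>A supremum of reals bounds its members only if the set is bounded above; here that follows because \<open>L\<close>
  is bounded below, so the quotients cannot exceed \<open>k / c\<close>.\<close>

lemma norm_le_mat_wnorm_gram:
  fixes L T :: "real^'n^'n"
  assumes inj: "inj ((*v) L)"
  shows "norm (L *v (T *v x)) \<le> mat_wnorm (transpose L ** L) (cmat T) * norm (L *v x)"
proof (cases "x = 0")
  case False
  let ?D = "transpose L ** L"
  obtain c where "c > 0" and c: "\<And>x. c * norm x \<le> norm (L *v x)"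
    using linear_inj_bounded_below_pos[OF matrix_vector_mul_linear inj] by blast
  obtain k where "k > 0" and k: "\<And>x. norm (L *v (T *v x)) \<le> norm x * k"
    using bounded_linear.pos_bounded[OF matrix_vector_mul_bounded_linear[of "L ** T"]]
    by (auto simp flip: matrix_vector_mul_assoc)
  have "norm (L *v (T *v x)) \<le> k / c * norm (L *v x)" for x
  proof -
    have "norm x * k \<le> norm (L *v x) / c * k"
      using c[of x] \<open>c > 0\<close> \<open>k > 0\<close> by (intro mult_right_mono) (simp_all add: field_simps)
    then show ?thesis using k[of x] by (simp add: mult.commute)
  qed
  then have "wnorm ?D (cmat T *v z) \<le> k / c * wnorm ?D z" for z
    using \<open>c > 0\<close> \<open>k > 0\<close> by (intro wnorm_gram_cmat_le) auto
  then have "bdd_above ((\<lambda>z. wnorm ?D (cmat T *v z) / wnorm ?D z) ` {z. z \<noteq> 0})"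
    using wnorm_gram_pos[OF inj] by (intro bdd_aboveI2[of _ _ "k / c"]) (simp add: divide_le_eq)
  moreover have "cvec x \<noteq> 0" using False by (auto simp: cvec_def vec_eq_iff)
  ultimately have "wnorm ?D (cmat T *v cvec x) / wnorm ?D (cvec x) \<le> mat_wnorm ?D (cmat T)"
    unfolding mat_wnorm_def by (intro cSUP_upper) auto
  moreover have "cmat T *v cvec x = cvec (T *v x)"
    by (simp add: vec_eq_iff cvec_def matrix_vector_mult_def map_matrix_def)
  moreover have "norm (L *v x) > 0" using injD[OF inj, of x 0] False by auto
  ultimately show ?thesis by (simp add: wnorm_gram_cvec divide_le_eq)
qed simp


section \<open>Coercivity of the projected problem\<close>

lemma matrix_inv_cancel:
  fixes A :: "real^'n^'n"
  assumes "invertible A"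
  shows "A ** matrix_inv A = mat 1" "matrix_inv A ** A = mat 1"
proof -
  have "A ** matrix_inv A = mat 1 \<and> matrix_inv A ** A = mat 1"
    using assms unfolding invertible_def matrix_inv_def by (rule someI_ex)
  then show "A ** matrix_inv A = mat 1" "matrix_inv A ** A = mat 1" by simp_all
qed

lemma inner_mult_transpose: "(A *v x) \<bullet> y = x \<bullet> (transpose A *v y)" for A :: "real^'n^'m"
  by (metis adjoint_matrix adjoint_clauses(1) inner_commute matrix_vector_mul_linear)

text \<open>The quadratic form attains its minimum on the compact unit sphere and is homogeneous.\<close>

lemma pos_def_coercive:
  fixes A :: "real^'n^'n"
  assumes "pos_def A"
  obtains c where "c > 0" "\<And>v. c * (norm v)\<^sup>2 \<le> v \<bullet> (A *v v)"
proof -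
  have "continuous_on (sphere 0 1) (\<lambda>v. v \<bullet> (A *v v))"
    by (intro continuous_intros linear_continuous_on matrix_vector_mul_bounded_linear)
  moreover have "axis undefined 1 \<in> (sphere 0 1 :: (real^'n) set)" by simp
  then have "(sphere 0 1 :: (real^'n) set) \<noteq> {}" by blast
  ultimately obtain u where u: "u \<in> sphere 0 1"
    and min: "\<And>v. v \<in> sphere 0 1 \<Longrightarrow> u \<bullet> (A *v u) \<le> v \<bullet> (A *v v)"
    using continuous_attains_inf[OF compact_sphere, of 0 1 "\<lambda>v. v \<bullet> (A *v v)"] by blast
  show thesis
  proof
    have "u \<noteq> 0" using u by auto
    then show "u \<bullet> (A *v u) > 0" using assms by (simp add: pos_def_def)
    fix v
    show "u \<bullet> (A *v u) * (norm v)\<^sup>2 \<le> v \<bullet> (A *v v)"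
    proof (cases "v = 0")
      case False
      then have "u \<bullet> (A *v u) \<le> ((1 / norm v) *\<^sub>R v) \<bullet> (A *v ((1 / norm v) *\<^sub>R v))"
        by (intro min) simp
      then show ?thesis using False
        by (simp add: mv.scaleR_right power2_eq_square field_simps)
    qed simp
  qed
qed

text \<open>The root is taken entrywise: off the diagonal \<open>sqrt 0 = 0\<close> keeps the matrix diagonal.\<close>

lemma diag_pos_gram_root:
  fixes D :: "real^'n^'n"
  assumes off: "\<And>i j. i \<noteq> j \<Longrightarrow> D $ i $ j = 0" and pos: "\<And>i. D $ i $ i > 0"
  shows "\<exists>L :: real^'n^'n. D = transpose L ** L \<and> inj ((*v) L)"
proof (intro exI conjI)
  let ?L = "map_matrix sqrt D"
  have "(\<Sum>k\<in>UNIV. sqrt (D $ k $ i) * sqrt (D $ k $ j)) = D $ i $ j" for i j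
  proof -
    have "sqrt (D $ k $ i) * sqrt (D $ k $ j) = (if k = i then D $ i $ j else 0)" for k
      using off[of k i] off[of i j] pos[of i] by (cases "i = j") auto
    then show ?thesis by simp
  qed
  then show "D = transpose ?L ** ?L"
    by (simp add: vec_eq_iff matrix_matrix_mult_def transpose_def map_matrix_def)
  have "x $ i = 0" if "?L *v x = 0" for x i
  proof -
    have "0 = (\<Sum>j\<in>UNIV. sqrt (D $ i $ j) * x $ j)"
      using that by (simp add: vec_eq_iff matrix_vector_mult_def map_matrix_def)
    also have "\<dots> = (\<Sum>j\<in>UNIV. if j = i then sqrt (D $ i $ i) * x $ i else 0)"
      using off by (intro sum.cong) auto
    finally show ?thesis using pos[of i] by simp
  qed
  then show "inj ((*v) ?L)"
    by (simp add: linear_injective_0 vec_eq_iff)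
qed

lemma reduced_eigendecompD:
  assumes "reduced_eigendecomp C V D"
  shows "transpose V ** V = mat 1" "C = V ** D ** transpose V"
    "C ** V = V ** D" "C ** (V ** transpose V) = C"
proof -
  show VV: "transpose V ** V = mat 1" and C: "C = V ** D ** transpose V"
    using assms by (simp_all add: reduced_eigendecomp_def)
  have "V ** D ** transpose V ** V = V ** D ** (transpose V ** V)"
    by (simp only: matrix_mul_assoc)
  then show CV: "C ** V = V ** D" by (simp add: VV flip: C)
  show "C ** (V ** transpose V) = C" by (simp add: matrix_mul_assoc CV flip: C)
qed

text \<open>Put \<open>d = D M v\<close> and \<open>g = G\<inverse> V d\<close>. Then \<open>v = B (M v) = V\<^sup>T g\<close>, so
  \<open>v \<bullet> D M v = g \<bullet> V d = g \<bullet> G g\<close>.\<close>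

lemma B11_inv_coercive:
  fixes C G :: "real^'N^'N" and V :: "real^'n^'N"
  assumes G: "pos_def G" and V: "reduced_eigendecomp C V D"
    and B: "B = transpose V ** matrix_inv G ** C ** V"
  shows "pos_def (D ** matrix_inv B)"
  unfolding pos_def_def
proof (intro allI impI)
  fix v :: "real^'n" assume "v \<noteq> 0"
  define d where "d = D *v (matrix_inv B *v v)"
  define g where "g = matrix_inv G *v (V *v d)"
  have "invertible B" unfolding B by (rule B11_invertible[OF G V])
  then have "v = B *v (matrix_inv B *v v)" by (simp add: matrix_inv_mult_vec)
  also have "\<dots> = transpose V *v (matrix_inv G *v ((C ** V) *v (matrix_inv B *v v)))"
    by (simp only: B matrix_vector_mul_assoc matrix_mul_assoc)
  also have "\<dots> = transpose V *v g"
    by (simp only: reduced_eigendecompD(3)[OF V] g_def d_def matrix_vector_mul_assoc matrix_mul_assoc)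
  finally have v: "v = transpose V *v g" .
  have "V *v d = G *v g"
    by (simp add: g_def matrix_inv_mult_vec pos_def_invertible[OF G])
  then have "v \<bullet> d = g \<bullet> (G *v g)"
    using inner_mult_transpose[of V d g] v by (simp add: inner_commute)
  moreover have "g \<noteq> 0" using v \<open>v \<noteq> 0\<close> by auto
  ultimately show "v \<bullet> ((D ** matrix_inv B) *v v) > 0"
    using G by (simp add: pos_def_def d_def flip: matrix_vector_mul_assoc)
qed

section \<open>Shift-and-invert Arnoldi\<close>

text \<open>\<open>C\<close> annihilates the orthogonal complement of its range, so it does not change if the projection
  \<open>V V\<^sup>T\<close> is inserted to its right.\<close>

lemma B11_intertwine:
  fixes C G :: "real^'N^'N" and V :: "real^'n^'N"
  assumes V: "reduced_eigendecomp C V D" and B: "B = transpose V ** matrix_inv G ** C ** V"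
  shows "transpose V *v (matrix_inv G *v (C *v q)) = B *v (transpose V *v q)"
proof -
  have "C *v q = (C ** (V ** transpose V)) *v q" by (simp only: reduced_eigendecompD(4)[OF V])
  then show ?thesis by (simp only: B matrix_vector_mul_assoc matrix_mul_assoc)
qed

text \<open>Let \<open>z = (C + \<gamma> G)\<inverse> C x\<close>. Multiplying \<open>(C + \<gamma> G) z = C x\<close> by \<open>V\<^sup>T G\<inverse>\<close> gives
  \<open>(B + \<gamma>) V\<^sup>T z = B V\<^sup>T x\<close>, and \<open>V\<^sup>T S x = V\<^sup>T z\<close>. So the inverse of the projected \<open>S\<close> is affine in
  \<open>B\<inverse>\<close>, the counterpart of \<open>A\<close> being affine in \<open>H\<inverse>\<close>.\<close>

lemma shift_invert_projected:
  fixes C G :: "real^'N^'N" and V :: "real^'n^'N"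
  assumes C: "sym_pos_semidef C" and G: "pos_def G" and "\<gamma> > 0" and V: "reduced_eigendecomp C V D"
    and B: "B = transpose V ** matrix_inv G ** C ** V"
    and S: "S = V ** transpose V ** matrix_inv (C + \<gamma> *\<^sub>R G) ** C"
  shows "(mat 1 + \<gamma> *\<^sub>R matrix_inv B) *v (transpose V *v (S *v x)) = transpose V *v x"
proof -
  note VD = reduced_eigendecompD[OF V]
  define z where "z = matrix_inv (C + \<gamma> *\<^sub>R G) *v (C *v x)"
  have "pos_def (C + \<gamma> *\<^sub>R G)"
    using C G \<open>\<gamma> > 0\<close> unfolding pos_def_def sym_pos_semidef_def
    by (simp add: mv.add_left mv.scaleR_left inner_add_right add_nonneg_pos)
  then have "(C + \<gamma> *\<^sub>R G) *v z = C *v x"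
    by (simp add: z_def matrix_inv_mult_vec pos_def_invertible)
  then have "matrix_inv G *v (C *v z + \<gamma> *\<^sub>R (G *v z)) = matrix_inv G *v (C *v x)"
    by (simp add: mv.add_left mv.scaleR_left)
  then have "matrix_inv G *v (C *v z) + \<gamma> *\<^sub>R z = matrix_inv G *v (C *v x)"
    using matrix_inv_cancel(2)[OF pos_def_invertible[OF G]]
    by (simp add: mv.add_right mv.scaleR_right matrix_vector_mul_assoc)
  then have "transpose V *v (matrix_inv G *v (C *v z)) + \<gamma> *\<^sub>R (transpose V *v z)
      = transpose V *v (matrix_inv G *v (C *v x))"
    by (metis mv.add_right mv.scaleR_right)
  then have "B *v (transpose V *v z) + \<gamma> *\<^sub>R (transpose V *v z) = B *v (transpose V *v x)"
    by (simp only: B11_intertwine[OF V B])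
  then have "matrix_inv B *v (B *v (transpose V *v z) + \<gamma> *\<^sub>R (transpose V *v z))
      = matrix_inv B *v (B *v (transpose V *v x))"
    by simp
  moreover have "matrix_inv B ** B = mat 1"
    using B11_invertible[OF G V] B by (simp add: matrix_inv_cancel)
  then have "matrix_inv B *v (B *v q) = q" for q
    by (simp only: matrix_vector_mul_assoc matrix_vector_mul_lid)
  ultimately have "transpose V *v z + \<gamma> *\<^sub>R (matrix_inv B *v (transpose V *v z)) = transpose V *v x"
    by (simp only: mv.add_right mv.scaleR_right)
  moreover have "transpose V *v (S *v x) = (transpose V ** V) *v (transpose V *v z)"
    by (simp only: S z_def matrix_vector_mul_assoc matrix_mul_assoc)
  ultimately show ?thesis
    by (simp only: VD(1) matrix_vector_mul_lid mv.add_left mv.scaleR_left)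
qed

lemma outer_mult: "outer u v *v x = (v \<bullet> x) *\<^sub>R u"
  by (simp add: vec_eq_iff outer_def matrix_vector_mult_def inner_vec_def sum_distrib_left mult_ac)

text \<open>Apply the Arnoldi relation to \<open>q = H\<inverse> p\<close>, remove \<open>S\<close> by multiplying with \<open>I + \<gamma> B\<inverse>\<close>, and solve
  for the term containing \<open>B\<inverse>\<close>.\<close>

lemma arnoldi_residual:
  fixes C G :: "real^'N^'N" and V :: "real^'n^'N"
    and W :: "real^'m::{finite,linorder}^'N" and H :: "real^'m::{finite,linorder}^'m::{finite,linorder}"
  assumes C: "sym_pos_semidef C" and G: "pos_def G" and "\<gamma> > 0" and V: "reduced_eigendecomp C V D"
    and B: "B = transpose V ** matrix_inv G ** C ** V"
    and S: "S = V ** transpose V ** matrix_inv (C + \<gamma> *\<^sub>R G) ** C"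
    and arnoldi: "C_arnoldi C S v W H h w"
    and A: "A = (1 / \<gamma>) *\<^sub>R (matrix_inv H - mat 1)"
  shows "matrix_inv B *v (transpose V *v (W *v p)) = transpose V *v (W *v (A *v p))
    - (h * (1 / \<gamma>) * (e_last \<bullet> (matrix_inv H *v p))) *\<^sub>R
        ((mat 1 + \<gamma> *\<^sub>R matrix_inv B) *v (transpose V *v w))"
proof -
  define q where "q = matrix_inv H *v p"
  let ?g = "mat 1 + \<gamma> *\<^sub>R matrix_inv B" and ?Z = "\<lambda>u. transpose V *v (W *v u)"
  have "invertible H"
    using C_arnoldi_invertible[OF C G \<open>\<gamma> > 0\<close> V] arnoldi unfolding S by blast
  then have Hq: "H *v q = p" by (simp add: q_def matrix_inv_mult_vec)
  have SW: "S ** W = W ** H + h *\<^sub>R outer w e_last" using arnoldi by (simp add: C_arnoldi_def)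
  have "S *v (W *v q) = W *v p + (h * (e_last \<bullet> q)) *\<^sub>R w"
    by (simp only: matrix_vector_mul_assoc SW mv.add_left mv.scaleR_left outer_mult scaleR_scaleR)
       (simp add: Hq flip: matrix_vector_mul_assoc)
  then have "?Z q = ?g *v (?Z p + (h * (e_last \<bullet> q)) *\<^sub>R (transpose V *v w))"
    using shift_invert_projected[OF C G \<open>\<gamma> > 0\<close> V B S, of "W *v q"]
    by (simp only: mv.add_right mv.scaleR_right)
  then have "?Z q = ?Z p + \<gamma> *\<^sub>R (matrix_inv B *v ?Z p) + (h * (e_last \<bullet> q)) *\<^sub>R (?g *v (transpose V *v w))"
    by (simp only: mv.add_right mv.scaleR_right mv.add_left mv.scaleR_left matrix_vector_mul_lid)
  then have "\<gamma> *\<^sub>R (matrix_inv B *v ?Z p)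
      = ?Z q - ?Z p - (h * (e_last \<bullet> q)) *\<^sub>R (?g *v (transpose V *v w))"
    by (simp only: algebra_simps)
  then have "(1 / \<gamma>) *\<^sub>R (\<gamma> *\<^sub>R (matrix_inv B *v ?Z p))
      = (1 / \<gamma>) *\<^sub>R (?Z q - ?Z p - (h * (e_last \<bullet> q)) *\<^sub>R (?g *v (transpose V *v w)))"
    by simp
  moreover have "?Z (A *v p) = (1 / \<gamma>) *\<^sub>R (?Z q - ?Z p)"
    by (simp only: A q_def mv.scaleR_left mv.diff_left mv.diff_right mv.scaleR_right matrix_vector_mul_lid)
  ultimately show ?thesis
    using \<open>\<gamma> > 0\<close> by (simp add: scaleR_right_diff_distrib q_def mult_ac)
qed

text \<open>\<open>W W\<^sup>T C\<close> is the \<open>C\<close>-orthogonal projection onto the span of the columns of \<open>W\<close>. It fixes the first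
  column, which is a multiple of the projection of \<open>x\<close>, and it sees of \<open>x\<close> only that projection. The
  normalising factor \<open>k\<close> is arbitrary: \<open>W\<^sup>T C W = I\<close> already forces it to be nonzero.\<close>

lemma arnoldi_initial:
  fixes C :: "real^'N^'N" and V :: "real^'n^'N" and W :: "real^'m::{finite,linorder}^'N"
  assumes V: "reduced_eigendecomp C V D"
    and arnoldi: "C_arnoldi C S (k *\<^sub>R ((V ** transpose V) *v x)) W H h w"
  shows "transpose V *v (W *v (transpose W *v (C *v x))) = transpose V *v x"
proof -
  note VD = reduced_eigendecompD[OF V]
  let ?e = "axis (Min UNIV) 1 :: real^'m::{finite,linorder}"
  let ?P = "V ** transpose V"
  have WCW: "transpose W ** C ** W = mat 1" and "column (Min UNIV) W = k *\<^sub>R (?P *v x)"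
    using arnoldi by (simp_all add: C_arnoldi_def)
  then have We: "W *v ?e = k *\<^sub>R (?P *v x)" by (simp add: matrix_vector_mult_basis)
  have "transpose W *v (C *v (W *v ?e)) = (transpose W ** C ** W) *v ?e"
    by (simp only: matrix_vector_mul_assoc matrix_mul_assoc)
  then have e: "transpose W *v (C *v (W *v ?e)) = ?e" by (simp only: WCW matrix_vector_mul_lid)
  have "C *v (W *v ?e) = k *\<^sub>R (C *v x)"
    by (simp only: We mv.scaleR_right matrix_vector_mul_assoc VD(4))
  then have k: "k *\<^sub>R (transpose W *v (C *v x)) = ?e" using e by (simp only: mv.scaleR_right)
  then have "k \<noteq> 0" by auto
  have "k *\<^sub>R (W *v (transpose W *v (C *v x))) = k *\<^sub>R (?P *v x)"
    using We k by (metis mv.scaleR_right)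
  then have "W *v (transpose W *v (C *v x)) = ?P *v x" using \<open>k \<noteq> 0\<close> by simp
  then have "transpose V *v (W *v (transpose W *v (C *v x))) = (transpose V ** V) *v (transpose V *v x)"
    by (simp only: matrix_vector_mul_assoc matrix_mul_assoc)
  then show ?thesis by (simp only: VD(1) matrix_vector_mul_lid)
qed

section \<open>The error estimate\<close>

theorem theorem2p8:
  fixes C G P S :: "real^'N^'N" and V :: "real^'n^'N" and C\<^sub>1 B :: "real^'n^'n"
    and \<gamma> :: real and x0 :: "real^'N"
    and W :: "real^'m::{finite,linorder}^'N" and H A :: "real^'m::{finite,linorder}^'m::{finite,linorder}"
    and h :: real and w :: "real^'N"
    and y y\<^sub>m \<epsilon> r :: "real \<Rightarrow> real^'N" and \<beta> :: "real \<Rightarrow> real"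
  assumes C: "sym_pos_semidef C"
    and G: "pos_def G"
    and \<gamma>: "\<gamma> > 0"
    and decomp: "reduced_eigendecomp C V C\<^sub>1"
    and P: "P = V ** transpose V"
    and x0: "P *v x0 \<noteq> 0"
    and B: "B = transpose V ** matrix_inv G ** C ** V"
    and S: "S = P ** matrix_inv (C + \<gamma> *\<^sub>R G) ** C"
    and arnoldi: "C_arnoldi C S ((1 / wnorm C (cvec x0)) *\<^sub>R (P *v x0)) W H h w"
    and A: "A = (1 / \<gamma>) *\<^sub>R (matrix_inv H - mat 1)"
    and y\<^sub>m: "\<And>t. y\<^sub>m t = W *v (mat_exp ((- t) *\<^sub>R A) *v (transpose W *v (C *v x0)))"
    and y: "\<And>t. y t = V *v (mat_exp ((- t) *\<^sub>R matrix_inv B) *v (transpose V *v x0))"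
    and \<epsilon>: "\<And>t. \<epsilon> t = y\<^sub>m t - y t"
    and r: "\<And>t. r t = (P ** matrix_inv G ** C) *v vector_derivative y\<^sub>m (at t) + y\<^sub>m t"
    and \<beta>: "\<And>t. \<beta> t = h * (1 / \<gamma>) *
              (e_last \<bullet> (matrix_inv H *v (mat_exp ((- t) *\<^sub>R A) *v (transpose W *v (C *v x0)))))"
  shows "(\<exists>K>0. \<exists>\<omega>>0. \<forall>t\<ge>0.
            mat_wnorm C\<^sub>1 (cmat (mat_exp ((- t) *\<^sub>R matrix_inv B))) \<le> K * exp (- t * \<omega>)) \<and>
         (\<forall>K>0. \<forall>\<omega>>0.
            (\<forall>t\<ge>0. mat_wnorm C\<^sub>1 (cmat (mat_exp ((- t) *\<^sub>R matrix_inv B))) \<le> K * exp (- t * \<omega>)) \<longrightarrow>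
            (\<forall>t\<ge>0.
               wnorm C (cvec (P *v \<epsilon> t))
                 \<le> K * t * phi1 (- t * \<omega>)
                     * (SUP s\<in>{0..t}. wnorm C\<^sub>1 (cvec (matrix_inv B *v (transpose V *v r s)))) \<and>
               K * t * phi1 (- t * \<omega>)
                     * (SUP s\<in>{0..t}. wnorm C\<^sub>1 (cvec (matrix_inv B *v (transpose V *v r s))))
                 \<le> K * t * phi1 (- t * \<omega>)
                     * wnorm C\<^sub>1 (cvec ((mat 1 + \<gamma> *\<^sub>R matrix_inv B) *v (transpose V *v w)))
                     * (SUP \<theta>\<in>{0..1}. \<bar>\<beta> (t * \<theta>)\<bar>)))"
proof -
  let ?M = "matrix_inv B" and ?c = "transpose W *v (C *v x0)"
  define p where "p t = mat_exp ((- t) *\<^sub>R A) *v ?c" for t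
  define \<rho> where "\<rho> = (mat 1 + \<gamma> *\<^sub>R ?M) *v (transpose V *v w)"
  note VD = reduced_eigendecompD[OF decomp]
  have "\<exists>L :: real^'n^'n. C\<^sub>1 = transpose L ** L \<and> inj ((*v) L)"
    using decomp by (intro diag_pos_gram_root) (simp_all add: reduced_eigendecomp_def)
  then obtain L :: "real^'n^'n" where L: "C\<^sub>1 = transpose L ** L" and inj: "inj ((*v) L)"
    by blast
  have "C = transpose (L ** transpose V) ** (L ** transpose V)"
    by (simp only: VD(2) L matrix_transpose_mul transpose_transpose matrix_mul_assoc)
  then have normC: "wnorm C (cvec x) = norm (L *v (transpose V *v x))" for x
    by (metis wnorm_gram_cvec matrix_vector_mul_assoc)
  have normC1: "wnorm C\<^sub>1 (cvec x) = norm (L *v x)" for x unfolding L by (rule wnorm_gram_cvec)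

  obtain c where "c > 0" and c: "\<And>v. c * (norm v)\<^sup>2 \<le> v \<bullet> ((C\<^sub>1 ** ?M) *v v)"
    using pos_def_coercive[OF B11_inv_coercive[OF G decomp B]] by blast
  obtain k where "k > 0" and k: "\<And>x. norm (L *v x) \<le> norm x * k"
    using bounded_linear.pos_bounded[OF matrix_vector_mul_bounded_linear[of L]] by blast
  have "c / k\<^sup>2 * (norm (L *v v))\<^sup>2 \<le> (L *v v) \<bullet> (L *v (?M *v v))" for v
  proof -
    have "(norm (L *v v))\<^sup>2 \<le> (norm v)\<^sup>2 * k\<^sup>2"
      using power_mono[OF k[of v] norm_ge_zero, of 2] by (simp add: power_mult_distrib)
    then have "c / k\<^sup>2 * (norm (L *v v))\<^sup>2 \<le> c / k\<^sup>2 * ((norm v)\<^sup>2 * k\<^sup>2)"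
      using \<open>c > 0\<close> by (intro mult_left_mono) auto
    also have "\<dots> = c * (norm v)\<^sup>2" using \<open>k > 0\<close> by simp
    also have "\<dots> \<le> (L *v v) \<bullet> (L *v (?M *v v))"
      using c[of v] by (simp only: L inner_mult_transpose matrix_vector_mul_assoc matrix_mul_assoc)
    finally show ?thesis .
  qed
  note flow_decay = norm_flow_decay[OF this]
  have "mat_wnorm C\<^sub>1 (cmat (mat_exp ((- t) *\<^sub>R ?M))) \<le> 1 * exp (- t * (c / k\<^sup>2))" if "t \<ge> 0" for t
    unfolding L
  proof (rule mat_wnorm_gram_le[OF _ _ inj])
    show "norm (L *v (mat_exp ((- t) *\<^sub>R ?M) *v x)) \<le> 1 * exp (- t * (c / k\<^sup>2)) * norm (L *v x)" for x
      using flow_decay[OF that, of x] by simp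
  qed simp
  moreover have "c / k\<^sup>2 > 0" using \<open>c > 0\<close> \<open>k > 0\<close> by simp
  ultimately have decay_ex: "\<exists>K>0. \<exists>\<omega>>0. \<forall>t\<ge>0.
      mat_wnorm C\<^sub>1 (cmat (mat_exp ((- t) *\<^sub>R ?M))) \<le> K * exp (- t * \<omega>)"
    using zero_less_one by blast

  have dy: "(y\<^sub>m has_vector_derivative - (W *v (A *v p t))) (at t)" for t
    using bounded_linear.has_vector_derivative[OF mv.bounded_linear_right flow_has_vector_derivative, of W A ?c t]
    unfolding y\<^sub>m[abs_def] p_def by (simp only: mv.minus_right)
  have residual: "transpose V *v (- (W *v (A *v p t))) + ?M *v (transpose V *v y\<^sub>m t) = - \<beta> t *\<^sub>R \<rho>" for t
    using arnoldi_residual[OF C G \<gamma> decomp B S[unfolded P] arnoldi A, of "p t"]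
    by (simp add: \<beta> y\<^sub>m \<rho>_def p_def mv.minus_right)
  have Mr: "?M *v (transpose V *v r t) = - \<beta> t *\<^sub>R \<rho>" for t
  proof -
    let ?d = "- (W *v (A *v p t))"
    have "transpose V *v ((P ** matrix_inv G ** C) *v ?d)
        = (transpose V ** V) *v (transpose V *v (matrix_inv G *v (C *v ?d)))"
      by (simp only: P matrix_vector_mul_assoc matrix_mul_assoc)
    also have "\<dots> = B *v (transpose V *v ?d)"
      by (simp only: VD(1) matrix_vector_mul_lid B11_intertwine[OF decomp B])
    finally have "?M *v (transpose V *v r t) = (?M ** B) *v (transpose V *v ?d) + ?M *v (transpose V *v y\<^sub>m t)"
      unfolding r vector_derivative_at[OF dy] by (simp only: mv.add_right matrix_vector_mul_assoc matrix_mul_assoc)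
    moreover have "?M ** B = mat 1"
      unfolding B by (rule matrix_inv_cancel) (rule B11_invertible[OF G decomp])
    ultimately show ?thesis using residual[of t] by (simp only: matrix_vector_mul_lid)
  qed

  \<comment> \<open>the error in coordinates of the range of \<open>C\<close>\<close>
  define e where "e t = transpose V *v y\<^sub>m t - mat_exp ((- t) *\<^sub>R ?M) *v (transpose V *v x0)" for t
  have "e 0 = 0"
    using arnoldi_initial[OF decomp arnoldi[unfolded P]] by (simp add: e_def y\<^sub>m mat_exp_0)
  have de: "(e has_vector_derivative - (?M *v e t) + - \<beta> t *\<^sub>R \<rho>) (at t)" for t
  proof -
    have "(e has_vector_derivative transpose V *v (- (W *v (A *v p t)))
        - - (?M *v (mat_exp ((- t) *\<^sub>R ?M) *v (transpose V *v x0)))) (at t)"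
      unfolding e_def
      by (intro has_vector_derivative_diff flow_has_vector_derivative
          bounded_linear.has_vector_derivative[OF mv.bounded_linear_right dy])
    moreover have "transpose V *v (- (W *v (A *v p t)))
        - - (?M *v (mat_exp ((- t) *\<^sub>R ?M) *v (transpose V *v x0))) = - (?M *v e t) + - \<beta> t *\<^sub>R \<rho>"
      unfolding residual[of t, symmetric] e_def by (simp add: mv.diff_right)
    ultimately show ?thesis by simp
  qed
  have error: "wnorm C (cvec (P *v \<epsilon> t)) = norm (L *v e t)" for t
  proof -
    have VP: "transpose V *v (P *v q) = transpose V *v q" for q
      by (simp only: P matrix_vector_mul_assoc matrix_mul_assoc VD(1) matrix_mul_lid)
    have "transpose V *v (V *v q) = q" for q
      by (simp only: matrix_vector_mul_assoc VD(1) matrix_vector_mul_lid)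
    then show ?thesis by (simp only: normC VP \<epsilon> y e_def mv.diff_right)
  qed

  have cont_\<beta>: "continuous_on T \<beta>" for T
    unfolding \<beta>[abs_def]
    by (intro continuous_on_mult continuous_on_inner continuous_on_const
        bounded_linear.continuous_on[OF mv.bounded_linear_right continuous_on_flow])
  \<comment> \<open>By continuity the suprema over compact intervals are upper bounds.\<close>
  have bdd: "bdd_above ((\<lambda>s. \<bar>\<beta> s\<bar> * norm (L *v \<rho>)) ` {0..t})" for t
    by (intro bounded_imp_bdd_above compact_imp_bounded compact_continuous_image
        continuous_on_mult continuous_on_rabs continuous_on_const cont_\<beta> compact_Icc)
  have residual_norm: "wnorm C\<^sub>1 (cvec (?M *v (transpose V *v r s))) = \<bar>\<beta> s\<bar> * norm (L *v \<rho>)" for s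
    unfolding normC1 Mr by (simp add: mv.scaleR_right mv.minus_right)
  have \<rho>_norm: "wnorm C\<^sub>1 (cvec ((mat 1 + \<gamma> *\<^sub>R ?M) *v (transpose V *v w))) = norm (L *v \<rho>)"
    unfolding normC1 \<rho>_def ..
  show ?thesis
    unfolding residual_norm \<rho>_norm error
  proof (intro conjI decay_ex allI impI)
    fix K \<omega> t :: real
    assume "K > 0" "\<omega> > 0" "t \<ge> 0"
      and decay: "\<forall>t\<ge>0. mat_wnorm C\<^sub>1 (cmat (mat_exp ((- t) *\<^sub>R ?M))) \<le> K * exp (- t * \<omega>)"
    show "norm (L *v e t) \<le> K * t * phi1 (- t * \<omega>) * (SUP s\<in>{0..t}. \<bar>\<beta> s\<bar> * norm (L *v \<rho>))"
    proof (rule duhamel_bound[OF \<open>K > 0\<close> \<open>\<omega> > 0\<close> \<open>t \<ge> 0\<close> _ de \<open>e 0 = 0\<close>])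
      fix s :: real and x assume "s \<ge> 0"
      then have "mat_wnorm C\<^sub>1 (cmat (mat_exp ((- s) *\<^sub>R ?M))) * norm (L *v x)
          \<le> K * exp (- s * \<omega>) * norm (L *v x)"
        using decay by (intro mult_right_mono) auto
      with norm_le_mat_wnorm_gram[OF inj, of "mat_exp ((- s) *\<^sub>R ?M)" x]
      show "norm (L *v (mat_exp ((- s) *\<^sub>R ?M) *v x)) \<le> K * exp (- s * \<omega>) * norm (L *v x)"
        unfolding L by linarith
    next
      fix s assume "s \<in> {0..t}"
      then show "norm (L *v (- \<beta> s *\<^sub>R \<rho>)) \<le> (SUP s\<in>{0..t}. \<bar>\<beta> s\<bar> * norm (L *v \<rho>))"
        using cSUP_upper[OF _ bdd, of s t] by (simp add: mv.scaleR_right mv.minus_right)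
    qed
    have rescale: "(\<lambda>\<theta>. \<bar>\<beta> (t * \<theta>)\<bar>) ` {0..1} = (\<lambda>s. \<bar>\<beta> s\<bar>) ` {0..t}"
    proof -
      have "(*) t ` {0..1} = {0..t}" using \<open>t \<ge> 0\<close> by (simp add: image_mult_atLeastAtMost_if)
      then show ?thesis by (metis (no_types, lifting) image_cong image_image)
    qed
    have bdd_\<beta>: "bdd_above ((\<lambda>s. \<bar>\<beta> s\<bar>) ` {0..t})"
      by (intro bounded_imp_bdd_above compact_imp_bounded compact_continuous_image
          continuous_on_rabs cont_\<beta> compact_Icc)
    have "\<bar>\<beta> s\<bar> * norm (L *v \<rho>) \<le> norm (L *v \<rho>) * (SUP \<theta>\<in>{0..1}. \<bar>\<beta> (t * \<theta>)\<bar>)" if "s \<in> {0..t}" for s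
      unfolding rescale mult.commute[of "\<bar>\<beta> s\<bar>"]
      by (intro mult_left_mono cSUP_upper[OF that bdd_\<beta>] norm_ge_zero)
    then have "(SUP s\<in>{0..t}. \<bar>\<beta> s\<bar> * norm (L *v \<rho>)) \<le> norm (L *v \<rho>) * (SUP \<theta>\<in>{0..1}. \<bar>\<beta> (t * \<theta>)\<bar>)"
      using \<open>t \<ge> 0\<close> by (intro cSUP_least) auto
    moreover have "K * t * phi1 (- t * \<omega>) \<ge> 0"
      using \<open>K > 0\<close> \<open>t \<ge> 0\<close> phi1_nonneg by simp
    ultimately
    show "K * t * phi1 (- t * \<omega>) * (SUP s\<in>{0..t}. \<bar>\<beta> s\<bar> * norm (L *v \<rho>))
        \<le> K * t * phi1 (- t * \<omega>) * norm (L *v \<rho>) * (SUP \<theta>\<in>{0..1}. \<bar>\<beta> (t * \<theta>)\<bar>)"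
      unfolding mult.assoc[of _ "norm (L *v \<rho>)"] by (rule mult_left_mono)
  qed
qed

end
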